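(* Let $G$ be a finite $r$-uniform hypergraph with maximum degree $\Delta$, and let $\mathcal{E}=\{E_1,\ldots,E_n\}$ be a partition of its edge set $E(G)$ with $|E_i|\ge r\Delta+1$ for all $i$. Then $\mathbf{RG}(\mathcal{M}(G),\mathcal{E})$ is connected.
   Context: The matching complex $\mathcal{M}(G)$ is the complex on ground set $E(G)$ whose simplices are the matchings (sets of pairwise disjoint edges). A full rainbow matching of $(G,\mathcal{E})$ is a matching containing exactly one edge from each $E_i$. $\mathbf{RG}(\mathcal{M}(G),\mathcal{E})$ is the graph on full rainbow matchings, two being adjacent if their union is a matching of size $n+1$. *)

theory Defs
  imports Main
begin

text \<open>A finite r-uniform hypergraph on vertex set V with edge set E (edges are r-element subsets of V).\<close>
definition uniform_hypergraph :: "nat \<Rightarrow> 'a set \<Rightarrow> 'a set set \<Rightarrow> bool" where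
  "uniform_hypergraph r V E \<longleftrightarrow> finite V \<and> (\<forall>e\<in>E. e \<subseteq> V \<and> card e = r)"

definition degree :: "'a set set \<Rightarrow> 'a \<Rightarrow> nat" where
  "degree E v = card {e\<in>E. v \<in> e}"

text \<open>Maximum degree (0 for the empty vertex set).\<close>
definition max_degree :: "'a set \<Rightarrow> 'a set set \<Rightarrow> nat" where
  "max_degree V E = Max (insert 0 (degree E ` V))"

text \<open>A matching of E: a set of edges of E that are pairwise disjoint.\<close>
definition is_matching :: "'a set set \<Rightarrow> 'a set set \<Rightarrow> bool" where
  "is_matching E M \<longleftrightarrow> M \<subseteq> E \<and> (\<forall>e\<in>M. \<forall>f\<in>M. e \<noteq> f \<longrightarrow> e \<inter> f = {})"

text \<open>Indexed family P 0, ..., P (n-1) partitions E.\<close>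
definition is_partition :: "'a set set \<Rightarrow> nat \<Rightarrow> (nat \<Rightarrow> 'a set set) \<Rightarrow> bool" where
  "is_partition E n P \<longleftrightarrow> (\<Union>i<n. P i) = E \<and> (\<forall>i<n. P i \<noteq> {})
      \<and> (\<forall>i<n. \<forall>j<n. i \<noteq> j \<longrightarrow> P i \<inter> P j = {})"

text \<open>Full rainbow matching: a matching containing exactly one edge from each class.\<close>
definition full_rainbow_matching :: "'a set set \<Rightarrow> nat \<Rightarrow> (nat \<Rightarrow> 'a set set) \<Rightarrow> 'a set set \<Rightarrow> bool" where
  "full_rainbow_matching E n P M \<longleftrightarrow> is_matching E M \<and> (\<forall>i<n. card (M \<inter> P i) = 1)"

text \<open>Edge relation of the graph RG(M(G), E): two full rainbow matchings whose union is a matching of size n+1.\<close>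
definition RG_adj :: "'a set set \<Rightarrow> nat \<Rightarrow> (nat \<Rightarrow> 'a set set) \<Rightarrow> ('a set set \<times> 'a set set) set" where
  "RG_adj E n P = {(M, M'). full_rainbow_matching E n P M \<and> full_rainbow_matching E n P M'
      \<and> is_matching E (M \<union> M') \<and> card (M \<union> M') = n + 1}"

text \<open>The graph RG is connected: any two vertices are joined by a path.\<close>
definition RG_connected :: "'a set set \<Rightarrow> nat \<Rightarrow> (nat \<Rightarrow> 'a set set) \<Rightarrow> bool" where
  "RG_connected E n P \<longleftrightarrow> (\<forall>M M'. full_rainbow_matching E n P M \<longrightarrow> full_rainbow_matching E n P M'
      \<longrightarrow> (M, M') \<in> (RG_adj E n P)\<^sup>*)"

end

theory Submission
  imports Defs Complex_Main
begin

text \<open>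
  Fix two full rainbow matchings \<open>M\<close>, \<open>M'\<close> and write \<open>M\<^sub>I\<close>, \<open>M'\<^sub>I\<close> for their parts in the classes
  indexed by \<open>I\<close>. If \<open>F\<close> is the union of the classes indexed by \<open>I\<close>, then \<open>|F| > r \<Delta> |I|\<close>, and a
  spectral-gap argument in the style of Garland and Aharoni--Berger--Meshulam shows that every
  real simplicial cycle on matchings of size \<open>|I|\<close> in \<open>F\<close> is a boundary. Hence there are
  inductively chains \<open>D\<^sub>I\<close> with boundary \<open>M\<^sub>I - M'\<^sub>I - \<Sum>\<^sub>i \<plusminus> D\<^bsub>I - i\<^esub>\<close>.
  For the full index set, only \<open>M - M'\<close> contributes full rainbow matchings to this boundary. On the
  other hand, a matching of size \<open>n + 1\<close> with a full rainbow facet has exactly two of them, they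
  are adjacent in the rainbow graph, and they occur with opposite signs in its boundary. So the
  coefficients of the boundary sum to zero over every connected component, and \<open>M\<close>, \<open>M'\<close> must lie
  in the same one.
\<close>

section \<open>Chains\<close>

text \<open>The injective key \<open>g\<close> linearly orders the vertices and thereby orients the simplices.\<close>

definition pos_sign :: "('v \<Rightarrow> nat) \<Rightarrow> 'v \<Rightarrow> 'v set \<Rightarrow> real" where
  "pos_sign g e S = (-1) ^ card {f\<in>S. g f < g e}"

text \<open>The simplicial boundary, read coefficientwise: \<open>S\<close> collects from its
  cofaces. Chains are real functions on all sets, with simplices singled out only by support; the
  value at \<open>{}\<close> is the augmentation, so homology is reduced.\<close>

definition bd :: "('v \<Rightarrow> nat) \<Rightarrow> 'v set \<Rightarrow> ('v set \<Rightarrow> real) \<Rightarrow> 'v set \<Rightarrow> real" where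
  "bd g F c S = (\<Sum>e\<in>F - S. pos_sign g e S * c (insert e S))"

lemma pos_sign_square [simp]: "(pos_sign g e S)\<^sup>2 = 1"
  by (simp add: pos_sign_def power2_eq_square flip: power_mult_distrib)

lemma pos_sign_insert:
  assumes "finite S" "f \<notin> S"
  shows "pos_sign g e (insert f S) = (if g f < g e then - pos_sign g e S else pos_sign g e S)"
proof -
  have "{h \<in> insert f S. g h < g e}
      = (if g f < g e then insert f {h\<in>S. g h < g e} else {h\<in>S. g h < g e})"
    by auto
  then show ?thesis using assms by (simp add: pos_sign_def)
qed

lemma pos_sign_remove: "pos_sign g e (S - {e}) = pos_sign g e S"
proof -
  have "{f \<in> S - {e}. g f < g e} = {f\<in>S. g f < g e}" by auto
  then show ?thesis by (simp add: pos_sign_def)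
qed

lemma pos_sign_swap:
  assumes "finite S" "e \<notin> S" "f \<notin> S" "g e \<noteq> g f"
  shows "pos_sign g e S * pos_sign g f (insert e S) = - (pos_sign g f S * pos_sign g e (insert f S))"
  using assms by (simp add: pos_sign_insert)

lemma sum_antisym_eq_0:
  fixes t :: "'v \<Rightarrow> 'v \<Rightarrow> real"
  assumes "\<And>e f. e \<in> A \<Longrightarrow> f \<in> A \<Longrightarrow> t e f = - t f e"
  shows "(\<Sum>e\<in>A. \<Sum>f\<in>A. t e f) = 0"
proof -
  have "(\<Sum>e\<in>A. \<Sum>f\<in>A. t e f) = (\<Sum>e\<in>A. \<Sum>f\<in>A. - t f e)"
    by (intro sum.cong refl assms)
  also have "\<dots> = - (\<Sum>e\<in>A. \<Sum>f\<in>A. t f e)" by (simp add: sum_negf)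
  also have "(\<Sum>e\<in>A. \<Sum>f\<in>A. t f e) = (\<Sum>e\<in>A. \<Sum>f\<in>A. t e f)" by (rule sum.swap)
  finally show ?thesis by simp
qed

lemma sum_antisym_remove_eq_0:
  fixes t :: "'v \<Rightarrow> 'v \<Rightarrow> real"
  assumes "finite A" "\<And>e f. e \<in> A \<Longrightarrow> f \<in> A \<Longrightarrow> e \<noteq> f \<Longrightarrow> t e f = - t f e"
  shows "(\<Sum>e\<in>A. \<Sum>f\<in>A - {e}. t e f) = 0"
proof -
  have "(\<Sum>e\<in>A. \<Sum>f\<in>A - {e}. t e f) = (\<Sum>e\<in>A. \<Sum>f\<in>A. if e = f then 0 else t e f)"
  proof (rule sum.cong[OF refl])
    fix e assume "e \<in> A"
    show "(\<Sum>f\<in>A - {e}. t e f) = (\<Sum>f\<in>A. if e = f then 0 else t e f)"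
      by (rule sum.mono_neutral_cong_left) (use assms(1) in auto)
  qed
  also have "\<dots> = 0"
  proof (rule sum_antisym_eq_0)
    fix e f assume "e \<in> A" "f \<in> A"
    then show "(if e = f then 0 else t e f) = - (if f = e then 0 else t f e)"
      using assms(2)[of e f] by (cases "e = f") simp_all
  qed
  finally show ?thesis .
qed

text \<open>Adding \<open>e\<close> and \<open>f\<close> in either order reaches the same coface,
  with opposite signs.\<close>

lemma bd_bd:
  assumes "finite F" "inj_on g F" "finite S"
  shows "bd g F (bd g F c) S = 0"
proof -
  have "bd g F (bd g F c) S = (\<Sum>e\<in>F - S. \<Sum>f\<in>(F - S) - {e}.
      (pos_sign g e S * pos_sign g f (insert e S)) * c (insert e (insert f S)))"
    unfolding bd_def sum_distrib_left
    by (intro sum.cong) (auto simp: insert_commute)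
  also have "\<dots> = 0"
  proof (rule sum_antisym_remove_eq_0)
    fix e f assume "e \<in> F - S" "f \<in> F - S" "e \<noteq> f"
    then have "g e \<noteq> g f" using assms(2) by (auto dest: inj_onD)
    then show "pos_sign g e S * pos_sign g f (insert e S) * c (insert e (insert f S)) =
       - (pos_sign g f S * pos_sign g e (insert f S) * c (insert f (insert e S)))"
      using pos_sign_swap[of S e f g] \<open>e \<in> F - S\<close> \<open>f \<in> F - S\<close> assms(3)
      by (simp add: insert_commute)
  qed (use assms in auto)
  finally show ?thesis .
qed

lemma bd_diff: "bd g F (\<lambda>S. a S - b S) S = bd g F a S - bd g F b S"
  by (simp add: bd_def algebra_simps sum_subtractf)

lemma bd_sum: "bd g F (\<lambda>S. \<Sum>i\<in>I. a i * b i S) S = (\<Sum>i\<in>I. a i * bd g F (b i) S)"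
  unfolding bd_def sum_distrib_left by (subst sum.swap) (simp add: algebra_simps)

text \<open>Gram-Schmidt: what is left of \<open>z\<close> after projection to the span of the
  \<open>A i\<close>. The induction hypothesis is applied both to the new vector \<open>A k\<close>
  and to \<open>z\<close>.\<close>

lemma orthogonal_remainder:
  fixes A :: "'i \<Rightarrow> 's \<Rightarrow> real"
  assumes "finite J" "finite X"
  shows "\<exists>c. \<forall>j\<in>J. (\<Sum>s\<in>X. (z s - (\<Sum>i\<in>J. c i * A i s)) * A j s) = 0"
  using assms(1)
proof (induction J arbitrary: z rule: finite_induct)
  case empty
  then show ?case by simp
next
  case (insert k J)
  define dot where "dot u v = (\<Sum>s\<in>X. u s * v s)" for u v :: "'s \<Rightarrow> real"
  from insert.IH[of "A k"] obtain a where
    a: "\<forall>j\<in>J. dot (\<lambda>s. A k s - (\<Sum>i\<in>J. a i * A i s)) (A j) = 0" unfolding dot_def by blast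
  from insert.IH[of z] obtain b where
    b: "\<forall>j\<in>J. dot (\<lambda>s. z s - (\<Sum>i\<in>J. b i * A i s)) (A j) = 0" unfolding dot_def by blast
  define p where "p s = A k s - (\<Sum>i\<in>J. a i * A i s)" for s
  define q where "q s = z s - (\<Sum>i\<in>J. b i * A i s)" for s
  \<comment> \<open>The projection coefficient of \<open>q\<close> along \<open>p\<close>. If
    \<open>p\<close> vanishes on \<open>X\<close>, there is nothing to remove and 0 is a safe
    default.\<close>
  define t where "t = (if dot p p = 0 then 0 else dot q p / dot p p)"
  have bil: "dot (\<lambda>s. u s - t * v s) w = dot u w - t * dot v w" for t u v w
    by (simp add: dot_def algebra_simps sum_subtractf sum_distrib_left)
  have p0: "dot p (A j) = 0" if "j \<in> J" for j using a that by (simp add: p_def[abs_def])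
  have q0: "dot q (A j) = 0" if "j \<in> J" for j using b that by (simp add: q_def[abs_def])
  \<comment> \<open>\<open>p\<close> differs from \<open>A k\<close> by a combination of the earlier
    vectors, to which \<open>v\<close> is orthogonal.\<close>
  have ex: "dot v (A k) = dot v p" if "\<And>j. j \<in> J \<Longrightarrow> dot v (A j) = 0" for v
  proof -
    have "dot v p = dot v (A k) - (\<Sum>i\<in>J. a i * dot v (A i))"
      unfolding dot_def p_def sum_distrib_left
      by (subst sum.swap) (simp add: algebra_simps sum_subtractf sum_distrib_left)
    then show ?thesis using that by simp
  qed
  have t: "dot q p - t * dot p p = 0"
  proof (cases "dot p p = 0")
    case True
    then have "\<forall>s\<in>X. p s = 0"
      using assms(2) by (simp add: dot_def sum_nonneg_eq_0_iff)
    then show ?thesis using True by (simp add: dot_def)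
  qed (simp add: t_def)
  define c where "c i = (if i = k then t else b i - t * a i)" for i
  have "z s - (\<Sum>i\<in>insert k J. c i * A i s) = q s - t * p s" for s
  proof -
    have "(\<Sum>i\<in>J. c i * A i s) = (\<Sum>i\<in>J. (b i - t * a i) * A i s)"
      using insert.hyps by (intro sum.cong) (auto simp: c_def)
    also have "\<dots> = (\<Sum>i\<in>J. b i * A i s) - t * (\<Sum>i\<in>J. a i * A i s)"
      by (simp add: algebra_simps sum_subtractf sum_distrib_left)
    finally show ?thesis
      using insert.hyps by (simp add: c_def p_def q_def algebra_simps)
  qed
  then have eq: "(\<Sum>s\<in>X. (z s - (\<Sum>i\<in>insert k J. c i * A i s)) * A j s)
      = dot q (A j) - t * dot p (A j)" for j
    by (simp add: bil[symmetric]) (simp add: dot_def)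
  have "dot q (A j) - t * dot p (A j) = 0" if "j \<in> insert k J" for j
    using that p0 q0 t ex[of p] ex[of q] by auto
  then show ?case using eq by metis
qed

text \<open>Simplices of the flag complex of \<open>adj\<close>. The index \<open>k\<close> counts
  vertices, so the dimension is \<open>k - 1\<close>; for finite \<open>F\<close>, index 0 gives the
  empty simplex alone.\<close>

definition cliques :: "('v \<Rightarrow> 'v \<Rightarrow> bool) \<Rightarrow> 'v set \<Rightarrow> nat \<Rightarrow> 'v set set" where
  "cliques adj F k = {S. S \<subseteq> F \<and> card S = k \<and> (\<forall>e\<in>S. \<forall>f\<in>S. e \<noteq> f \<longrightarrow> adj e f)}"

section \<open>Vanishing homology from a spectral gap\<close>

locale flag_complex =
  fixes g :: "'v \<Rightarrow> nat" and F :: "'v set" and adj :: "'v \<Rightarrow> 'v \<Rightarrow> bool"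
  assumes finF: "finite F" and inj: "inj_on g F"
    and adj_sym: "adj e f \<Longrightarrow> adj f e" and adj_irrefl: "\<not> adj e e"
begin

abbreviation faces :: "nat \<Rightarrow> 'v set set" where
  "faces \<equiv> cliques adj F"

definition link :: "'v set \<Rightarrow> 'v set" where
  "link S = {u\<in>F. \<forall>v\<in>S. adj u v}"

lemma finite_faces: "finite (faces k)"
  using finF by (auto simp: cliques_def intro: finite_subset[of _ "Pow F"])

lemma finite_link: "finite (link S)"
  using finF by (simp add: link_def)

lemma face_finite: "S \<in> faces k \<Longrightarrow> finite S"
  using finF by (auto simp: cliques_def intro: finite_subset)

lemma link_notin: "u \<in> link S \<Longrightarrow> u \<notin> S"
  using adj_irrefl by (auto simp: link_def)

lemma insert_face: "S \<in> faces k \<Longrightarrow> u \<in> link S \<Longrightarrow> insert u S \<in> faces (Suc k)"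
  using link_notin[of u S] face_finite[of S k]
  by (auto simp: cliques_def link_def intro: adj_sym)

lemma remove_face: "S \<in> faces (Suc k) \<Longrightarrow> e \<in> S \<Longrightarrow> S - {e} \<in> faces k \<and> e \<in> link (S - {e})"
  using face_finite[of S "Suc k"] by (auto simp: cliques_def link_def)

lemma insert_face_imp:
  assumes "insert u S \<in> faces (Suc k)" "u \<notin> S"
  shows "S \<in> faces k" "u \<in> link S"
  using remove_face[OF assms(1), of u] assms(2) by auto

text \<open>Sending \<open>(S, e)\<close> to \<open>(insert e S, e)\<close> matches extensions of
  smaller faces with vertices of larger ones.\<close>

lemma double_count:
  fixes h :: "'v \<Rightarrow> 'v set \<Rightarrow> real"
  shows "(\<Sum>S\<in>faces k. \<Sum>e\<in>link S. h e S) = (\<Sum>S\<in>faces (Suc k). \<Sum>e\<in>S. h e (S - {e}))"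
proof -
  have "(\<Sum>S\<in>faces k. \<Sum>e\<in>link S. h e S) = (\<Sum>(S,e)\<in>Sigma (faces k) link. h e S)"
    using finite_faces finite_link by (intro sum.Sigma) auto
  also have "\<dots> = (\<Sum>(S,e)\<in>Sigma (faces (Suc k)) (\<lambda>S. S). h e (S - {e}))"
    by (rule sum.reindex_bij_witness[of _ "\<lambda>(S,e). (S - {e}, e)" "\<lambda>(S,e). (insert e S, e)"])
      (auto dest: link_notin remove_face insert_face)
  also have "\<dots> = (\<Sum>S\<in>faces (Suc k). \<Sum>e\<in>S. h e (S - {e}))"
    using finite_faces face_finite by (intro sum.Sigma[symmetric]) auto
  finally show ?thesis .
qed

lemma bd_link:
  assumes "\<And>S. S \<notin> faces (Suc k) \<Longrightarrow> c S = 0"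
  shows "bd g F c S = (\<Sum>e\<in>link S. pos_sign g e S * c (insert e S))"
  unfolding bd_def
proof (rule sum.mono_neutral_right)
  show "link S \<subseteq> F - S" using link_notin[of _ S] unfolding link_def by blast
  show "\<forall>e\<in>F - S - link S. pos_sign g e S * c (insert e S) = 0"
  proof
    fix e assume "e \<in> F - S - link S"
    then have "insert e S \<notin> faces (Suc k)" using insert_face_imp(2)[of e S k] by blast
    then show "pos_sign g e S * c (insert e S) = 0" by (simp add: assms)
  qed
qed (use finF in auto)

lemma bd_support:
  assumes "\<And>S. S \<notin> faces (Suc k) \<Longrightarrow> c S = 0" "S \<notin> faces k"
  shows "bd g F c S = 0"
proof -
  have "c (insert e S) = 0" if "e \<in> link S" for e
    by (rule assms(1)) (use assms(2) insert_face_imp(1)[of e S k] link_notin[OF that] in blast)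
  moreover have "bd g F c S = (\<Sum>e\<in>link S. pos_sign g e S * c (insert e S))"
    by (rule bd_link) (rule assms(1))
  ultimately show ?thesis by simp
qed

text \<open>The coboundary is the transpose of the boundary. This serves twice: a chain orthogonal
  to all boundaries is a cocycle, and the boundary of the final filling can be moved onto the
  indicator of a component.\<close>

lemma bd_adjoint:
  assumes "\<And>S. S \<notin> faces (Suc k) \<Longrightarrow> c S = 0"
  shows "(\<Sum>S\<in>faces k. b S * bd g F c S)
    = (\<Sum>T\<in>faces (Suc k). c T * (\<Sum>e\<in>T. pos_sign g e T * b (T - {e})))"
proof -
  have bd: "bd g F c S = (\<Sum>e\<in>link S. pos_sign g e S * c (insert e S))" for S
    by (rule bd_link) (rule assms)
  have "(\<Sum>S\<in>faces k. b S * bd g F c S)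
      = (\<Sum>S\<in>faces k. \<Sum>e\<in>link S. b S * (pos_sign g e S * c (insert e S)))"
    unfolding bd sum_distrib_left ..
  also have "\<dots> = (\<Sum>T\<in>faces (Suc k). \<Sum>e\<in>T. b (T - {e}) * (pos_sign g e (T - {e}) * c (insert e (T - {e}))))"
    by (rule double_count)
  also have "\<dots> = (\<Sum>T\<in>faces (Suc k). c T * (\<Sum>e\<in>T. pos_sign g e T * b (T - {e})))"
    unfolding sum_distrib_left
    by (intro sum.cong refl) (simp add: pos_sign_remove insert_absorb)
  finally show ?thesis .
qed

text \<open>Count from the side of \<open>f\<close>: a vertex outside the link misses one of the
  \<open>k + 1\<close> vertices of \<open>S\<close>, so it contributes at most \<open>k\<close>; one
  in the link contributes at most one more.\<close>

lemma sum_degree_le: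
  assumes "S \<in> faces (Suc k)"
  shows "(\<Sum>e\<in>S. card {f\<in>F. adj e f}) \<le> card F * k + card (link S)"
proof -
  have finS: "finite S" using assms face_finite by blast
  have "(\<Sum>e\<in>S. card {f\<in>F. adj e f}) = (\<Sum>e\<in>S. \<Sum>f\<in>F. if adj e f then 1 else 0)"
    using finF by (intro sum.cong) (auto simp: sum.If_cases Int_def)
  also have "\<dots> = (\<Sum>f\<in>F. \<Sum>e\<in>S. if adj e f then 1 else 0)" by (rule sum.swap)
  also have "\<dots> \<le> (\<Sum>f\<in>F. k + (if f \<in> link S then 1 else 0))"
  proof (rule sum_mono)
    fix f assume f: "f \<in> F"
    have eq: "(\<Sum>e\<in>S. if adj e f then 1 else 0) = card {e\<in>S. adj e f}"
      using finS by (simp add: sum.If_cases Int_def)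
    have cS: "card S = Suc k" using assms by (simp add: cliques_def)
    show "(\<Sum>e\<in>S. if adj e f then 1 else 0) \<le> k + (if f \<in> link S then 1 else 0)"
    proof (cases "f \<in> link S")
      case True
      then show ?thesis using card_mono[OF finS, of "{e\<in>S. adj e f}"] cS eq by simp
    next
      case False
      then obtain v where "v \<in> S" "\<not> adj f v" using f by (auto simp: link_def)
      then have "v \<in> S" "v \<notin> {e\<in>S. adj e f}" using adj_sym[of v f] by auto
      then have "{e\<in>S. adj e f} \<subset> S" by blast
      then have "card {e\<in>S. adj e f} < Suc k" using psubset_card_mono[OF finS] cS by metis
      then show ?thesis using eq by simp
    qed
  qed
  also have "\<dots> = card F * k + card (link S)"
    using finF by (simp add: sum.distrib sum.If_cases Int_def link_def)
  finally show ?thesis .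
qed

text \<open>Expand the square. Diagonal terms count each \<open>S\<close> once per coface; an
  off-diagonal pair \<open>u\<close>, \<open>w\<close> in \<open>T\<close> is charged to the face
  \<open>T - {u} - {w}\<close>.\<close>

lemma coboundary_norm:
  fixes \<phi> :: "'v set \<Rightarrow> real"
  defines "x \<equiv> \<lambda>S e. pos_sign g e S * \<phi> (insert e S)"
  shows "(\<Sum>T\<in>faces (Suc (Suc k)). (\<Sum>u\<in>T. pos_sign g u T * \<phi> (T - {u}))\<^sup>2)
    = (\<Sum>S\<in>faces (Suc k). card (link S) * (\<phi> S)\<^sup>2)
      - (\<Sum>S\<in>faces k. \<Sum>e\<in>link S. \<Sum>f\<in>link (insert e S). x S e * x S f)"
proof -
  have "(\<Sum>T\<in>faces (Suc (Suc k)). (\<Sum>u\<in>T. pos_sign g u T * \<phi> (T - {u}))\<^sup>2)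
    = (\<Sum>T\<in>faces (Suc (Suc k)). (\<Sum>u\<in>T. (\<phi> (T - {u}))\<^sup>2
          - (\<Sum>w\<in>T - {u}. x (T - {u} - {w}) w * x (T - {u} - {w}) u)))"
  proof (rule sum.cong)
    fix T assume T: "T \<in> faces (Suc (Suc k))"
    then have finT: "finite T" by (rule face_finite)
    have TF: "T \<subseteq> F" using T by (simp add: cliques_def)
    have "(\<Sum>u\<in>T. pos_sign g u T * \<phi> (T - {u}))\<^sup>2
        = (\<Sum>u\<in>T. \<Sum>w\<in>T. (pos_sign g u T * \<phi> (T - {u})) * (pos_sign g w T * \<phi> (T - {w})))"
      by (simp add: power2_eq_square sum_product)
    also have "\<dots> = (\<Sum>u\<in>T. (\<phi> (T - {u}))\<^sup>2
          - (\<Sum>w\<in>T - {u}. x (T - {u} - {w}) w * x (T - {u} - {w}) u))"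
    proof (rule sum.cong)
      fix u assume u: "u \<in> T"
      have "(\<Sum>w\<in>T. (pos_sign g u T * \<phi> (T - {u})) * (pos_sign g w T * \<phi> (T - {w})))
        = (pos_sign g u T * \<phi> (T - {u})) * (pos_sign g u T * \<phi> (T - {u}))
          + (\<Sum>w\<in>T - {u}. (pos_sign g u T * \<phi> (T - {u})) * (pos_sign g w T * \<phi> (T - {w})))"
        using finT u by (rule sum.remove)
      also have "(pos_sign g u T * \<phi> (T - {u})) * (pos_sign g u T * \<phi> (T - {u})) = (\<phi> (T - {u}))\<^sup>2"
        by (simp flip: power2_eq_square add: power_mult_distrib)
      also have "(\<Sum>w\<in>T - {u}. (pos_sign g u T * \<phi> (T - {u})) * (pos_sign g w T * \<phi> (T - {w})))
        = (\<Sum>w\<in>T - {u}. - (x (T - {u} - {w}) w * x (T - {u} - {w}) u))"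
      proof (rule sum.cong)
        fix w assume w: "w \<in> T - {u}"
        define S where "S = T - {u} - {w}"
        have S: "finite S" "u \<notin> S" "w \<notin> S" "u \<noteq> w" "T - {u} = insert w S" "T - {w} = insert u S"
          "T = insert u (insert w S)"
          using u w finT by (auto simp: S_def)
        \<comment> \<open>From \<open>S\<close> to \<open>T\<close>, exactly one of \<open>u\<close>
          and \<open>w\<close> gains the other as a predecessor, so exactly one of the two signs
          flips.\<close>
        have "g u \<noteq> g w" using u w TF inj by (auto dest: inj_onD)
        then have "pos_sign g u T * pos_sign g w T = - (pos_sign g u S * pos_sign g w S)"
          using S by (simp add: pos_sign_insert)
        moreover have "(pos_sign g u T * \<phi> (T - {u})) * (pos_sign g w T * \<phi> (T - {w}))
            = (pos_sign g u T * pos_sign g w T) * (\<phi> (insert w S) * \<phi> (insert u S))"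
          unfolding S(5) S(6) by simp
        ultimately show "(pos_sign g u T * \<phi> (T - {u})) * (pos_sign g w T * \<phi> (T - {w}))
            = - (x (T - {u} - {w}) w * x (T - {u} - {w}) u)"
          unfolding S_def[symmetric] x_def by simp
      qed simp
      finally show "(\<Sum>w\<in>T. (pos_sign g u T * \<phi> (T - {u})) * (pos_sign g w T * \<phi> (T - {w})))
        = (\<phi> (T - {u}))\<^sup>2 - (\<Sum>w\<in>T - {u}. x (T - {u} - {w}) w * x (T - {u} - {w}) u)"
        by (simp add: sum_negf)
    qed simp
    finally show "(\<Sum>u\<in>T. pos_sign g u T * \<phi> (T - {u}))\<^sup>2 = (\<Sum>u\<in>T. (\<phi> (T - {u}))\<^sup>2
          - (\<Sum>w\<in>T - {u}. x (T - {u} - {w}) w * x (T - {u} - {w}) u))" .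
  qed simp
  also have "\<dots> = (\<Sum>S\<in>faces (Suc k). \<Sum>u\<in>link S. (\<phi> S)\<^sup>2
          - (\<Sum>w\<in>S. x (S - {w}) w * x (S - {w}) u))"
    by (rule double_count[symmetric])
  also have "\<dots> = (\<Sum>S\<in>faces (Suc k). card (link S) * (\<phi> S)\<^sup>2)
      - (\<Sum>S\<in>faces (Suc k). \<Sum>w\<in>S. \<Sum>u\<in>link S. x (S - {w}) w * x (S - {w}) u)"
    by (simp add: sum_subtractf sum.swap[of _ "link _"])
  \<comment> \<open>Writing \<open>S\<close> as \<open>insert w (S - {w})\<close> makes the summand
    a function of \<open>w\<close> and \<open>S - {w}\<close>, so that \<open>double_count\<close>
    applies one level down.\<close>
  also have "(\<Sum>S\<in>faces (Suc k). \<Sum>w\<in>S. \<Sum>u\<in>link S. x (S - {w}) w * x (S - {w}) u)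
    = (\<Sum>S\<in>faces (Suc k). \<Sum>w\<in>S. \<Sum>u\<in>link (insert w (S - {w})). x (S - {w}) w * x (S - {w}) u)"
    by (intro sum.cong) (auto simp: insert_absorb)
  also have "\<dots> = (\<Sum>S\<in>faces k. \<Sum>e\<in>link S. \<Sum>f\<in>link (insert e S). x S e * x S f)"
    by (rule double_count[symmetric])
  finally show ?thesis .
qed

text \<open>
  For a \<open>k\<close>-face \<open>S\<close>, let \<open>x S\<close> be the function \<open>e \<mapsto> \<plusminus> \<phi> (S \<union> {e})\<close> on the vertices. Its values sum to \<open>0\<close>
  because \<open>\<phi>\<close> is a cycle, so the gap bounds its Dirichlet energy over adjacent pairs from below.
  Since \<open>\<phi>\<close> is a cocycle, the energy summed over all \<open>S\<close> is a weighted square norm of \<open>\<phi>\<close>, and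
  \<open>sum_degree_le\<close> bounds the weights from above.
\<close>

lemma harmonic_eq_0:
  fixes \<phi> :: "'v set \<Rightarrow> real"
  assumes supp: "\<And>S. S \<notin> faces (Suc k) \<Longrightarrow> \<phi> S = 0"
    and cycle: "\<And>S. S \<in> faces k \<Longrightarrow> bd g F \<phi> S = 0"
    and cocycle: "\<And>T. T \<in> faces (Suc (Suc k)) \<Longrightarrow> (\<Sum>u\<in>T. pos_sign g u T * \<phi> (T - {u})) = 0"
    and gap: "\<And>x :: 'v \<Rightarrow> real. (\<Sum>e\<in>F. \<Sum>f\<in>F. if adj e f then 0 else (x e - x f)\<^sup>2)
        \<le> 2 * \<kappa> * (\<Sum>e\<in>F. (x e)\<^sup>2)"
    and large: "real (card F) > \<kappa> * real (Suc k)"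
  shows "\<phi> S = 0"
proof -
  define m where "m = real (card F)"
  define N where "N = (\<Sum>S\<in>faces (Suc k). (\<phi> S)\<^sup>2)"
  define d where "d e = real (card {f\<in>F. adj e f})" for e
  \<comment> \<open>Extension by 0 off the link allows \<open>gap\<close>, which concerns functions
    on all of \<open>F\<close>, to be applied.\<close>
  define x where "x S e = (if e \<in> link S then pos_sign g e S * \<phi> (insert e S) else 0)" for S e
  have link_F: "link S \<subseteq> F" for S by (auto simp: link_def)
  have sumF: "(\<Sum>e\<in>F. h e * (x S e)\<^sup>2) = (\<Sum>e\<in>link S. h e * (\<phi> (insert e S))\<^sup>2)" for S h
  proof -
    have "(\<Sum>e\<in>F. h e * (x S e)\<^sup>2) = (\<Sum>e\<in>link S. h e * (x S e)\<^sup>2)"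
      using finF link_F by (intro sum.mono_neutral_right) (auto simp: x_def)
    also have "\<dots> = (\<Sum>e\<in>link S. h e * (\<phi> (insert e S))\<^sup>2)"
      by (intro sum.cong) (auto simp: x_def power_mult_distrib)
    finally show ?thesis .
  qed
  \<comment> \<open>A face occurs once for each of its vertices; the constant weight 1 yields the
    factor \<open>Suc k\<close> in \<open>norm\<close>.\<close>
  have weighted: "(\<Sum>S\<in>faces k. \<Sum>e\<in>F. h e * (x S e)\<^sup>2)
      = (\<Sum>S\<in>faces (Suc k). (\<Sum>e\<in>S. h e) * (\<phi> S)\<^sup>2)" for h
    unfolding sumF double_count sum_distrib_right
    by (intro sum.cong) (auto simp: insert_absorb)
  have norm: "(\<Sum>S\<in>faces k. \<Sum>e\<in>F. (x S e)\<^sup>2) = real (Suc k) * N"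
    using weighted[of "\<lambda>_. 1"] by (simp add: N_def sum_distrib_left cliques_def)
  have cross: "(\<Sum>S\<in>faces k. \<Sum>e\<in>F. \<Sum>f\<in>F. if adj e f then x S e * x S f else 0)
      = (\<Sum>S\<in>faces (Suc k). card (link S) * (\<phi> S)\<^sup>2)"
  proof -
    have "(\<Sum>S\<in>faces k. \<Sum>e\<in>F. \<Sum>f\<in>F. if adj e f then x S e * x S f else 0)
      = (\<Sum>S\<in>faces k. \<Sum>e\<in>link S. \<Sum>f\<in>link (insert e S).
          (pos_sign g e S * \<phi> (insert e S)) * (pos_sign g f S * \<phi> (insert f S)))"
    proof (rule sum.cong[OF refl], rule sum.mono_neutral_cong_right)
      fix S e assume e: "e \<in> link S"
      show "(\<Sum>f\<in>F. if adj e f then x S e * x S f else 0) = (\<Sum>f\<in>link (insert e S).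
          (pos_sign g e S * \<phi> (insert e S)) * (pos_sign g f S * \<phi> (insert f S)))"
        using e finF link_F adj_sym
        by (intro sum.mono_neutral_cong_right) (auto simp: x_def link_def)
    qed (use finF link_F in \<open>auto simp: x_def intro!: sum.neutral\<close>)
    \<comment> \<open>For a cocycle the left side of \<open>coboundary_norm\<close> is 0, so the
      cross terms equal the diagonal ones.\<close>
    then show ?thesis using coboundary_norm[of \<phi> k] cocycle by simp
  qed
  have total: "(\<Sum>e\<in>F. \<Sum>f\<in>F. (x S e - x S f)\<^sup>2) = 2 * m * (\<Sum>e\<in>F. (x S e)\<^sup>2)"
    if S: "S \<in> faces k" for S
  proof -
    have "bd g F \<phi> S = (\<Sum>e\<in>link S. pos_sign g e S * \<phi> (insert e S))"
      by (rule bd_link) (rule supp)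
    also have "\<dots> = (\<Sum>e\<in>F. x S e)"
      by (rule sum.mono_neutral_cong_left) (use finF link_F in \<open>auto simp: x_def\<close>)
    finally have "(\<Sum>e\<in>F. x S e) = bd g F \<phi> S" ..
    then have 0: "(\<Sum>e\<in>F. x S e) = 0" using cycle S by simp
    have "(\<Sum>e\<in>F. \<Sum>f\<in>F. (x S e - x S f)\<^sup>2)
      = (\<Sum>e\<in>F. m * (x S e)\<^sup>2 + (\<Sum>f\<in>F. (x S f)\<^sup>2) - 2 * x S e * (\<Sum>f\<in>F. x S f))"
      by (intro sum.cong) (simp_all add: power2_diff sum.distrib sum_subtractf sum_distrib_left m_def)
    then show ?thesis by (simp add: 0 sum.distrib sum_distrib_left[symmetric] m_def)
  qed
  have adjpart: "(\<Sum>e\<in>F. \<Sum>f\<in>F. if adj e f then (x S e - x S f)\<^sup>2 else 0)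
      = 2 * (\<Sum>e\<in>F. d e * (x S e)\<^sup>2) - 2 * (\<Sum>e\<in>F. \<Sum>f\<in>F. if adj e f then x S e * x S f else 0)" for S
  proof -
    have d: "(\<Sum>f\<in>F. if adj e f then c else 0) = d e * c" for e and c :: real
      using finF by (simp add: sum.If_cases d_def Int_def)
    have "(\<Sum>e\<in>F. \<Sum>f\<in>F. if adj e f then (x S e - x S f)\<^sup>2 else 0)
      = (\<Sum>e\<in>F. \<Sum>f\<in>F. (if adj e f then (x S e)\<^sup>2 else 0) + (if adj e f then (x S f)\<^sup>2 else 0)
          - 2 * (if adj e f then x S e * x S f else 0))"
      by (intro sum.cong) (auto simp: power2_diff)
    also have "\<dots> = (\<Sum>e\<in>F. \<Sum>f\<in>F. (if adj e f then (x S e)\<^sup>2 else 0))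
        + (\<Sum>e\<in>F. \<Sum>f\<in>F. (if adj e f then (x S f)\<^sup>2 else 0))
        - 2 * (\<Sum>e\<in>F. \<Sum>f\<in>F. if adj e f then x S e * x S f else 0)"
      by (simp add: sum.distrib sum_subtractf sum_distrib_left)
    also have "(\<Sum>e\<in>F. \<Sum>f\<in>F. (if adj e f then (x S f)\<^sup>2 else 0))
        = (\<Sum>f\<in>F. \<Sum>e\<in>F. (if adj f e then (x S f)\<^sup>2 else 0))"
      by (subst sum.swap) (intro sum.cong, auto dest: adj_sym)
    finally show ?thesis by (simp add: d)
  qed
  \<comment> \<open>All pairs split into the adjacent ones, evaluated by \<open>adjpart\<close>, and
    the rest, bounded by \<open>gap\<close>.\<close>
  have "2 * m * (real (Suc k) * N) = (\<Sum>S\<in>faces k. \<Sum>e\<in>F. \<Sum>f\<in>F. (x S e - x S f)\<^sup>2)"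
    unfolding norm[symmetric] sum_distrib_left[of "2 * m" _ "faces k"]
    by (intro sum.cong refl total[symmetric])
  also have "\<dots> = (\<Sum>S\<in>faces k. (\<Sum>e\<in>F. \<Sum>f\<in>F. if adj e f then (x S e - x S f)\<^sup>2 else 0)
      + (\<Sum>e\<in>F. \<Sum>f\<in>F. if adj e f then 0 else (x S e - x S f)\<^sup>2))"
    by (subst sum.distrib[symmetric])+ (intro sum.cong, auto)
  also have "\<dots> \<le> (\<Sum>S\<in>faces k. (2 * (\<Sum>e\<in>F. d e * (x S e)\<^sup>2)
        - 2 * (\<Sum>e\<in>F. \<Sum>f\<in>F. if adj e f then x S e * x S f else 0)) + 2 * \<kappa> * (\<Sum>e\<in>F. (x S e)\<^sup>2))"
    unfolding adjpart using gap by (intro sum_mono add_left_mono) auto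
  also have "\<dots> = 2 * (\<Sum>S\<in>faces (Suc k). ((\<Sum>e\<in>S. d e) - card (link S)) * (\<phi> S)\<^sup>2)
      + 2 * \<kappa> * (real (Suc k) * N)"
    unfolding sum.distrib sum_subtractf sum_distrib_left[symmetric] weighted cross norm
    by (simp add: algebra_simps sum_subtractf)
  also have "(\<Sum>S\<in>faces (Suc k). ((\<Sum>e\<in>S. d e) - card (link S)) * (\<phi> S)\<^sup>2)
      \<le> (\<Sum>S\<in>faces (Suc k). (m * k) * (\<phi> S)\<^sup>2)"
  proof (intro sum_mono mult_right_mono)
    fix S assume "S \<in> faces (Suc k)"
    from sum_degree_le[OF this]
    have "real (\<Sum>e\<in>S. card {f\<in>F. adj e f}) \<le> real (card F * k + card (link S))"
      by (rule of_nat_mono)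
    then show "(\<Sum>e\<in>S. d e) - card (link S) \<le> m * k"
      by (simp add: d_def m_def)
  qed auto
  also have "(\<Sum>S\<in>faces (Suc k). (m * k) * (\<phi> S)\<^sup>2) = m * k * N"
    by (simp add: N_def sum_distrib_left)
  \<comment> \<open>The degree bound uses up \<open>m * k * N\<close> of the
    \<open>m * (k + 1) * N\<close> on the left, so one \<open>m * N\<close> remains against
    \<open>\<kappa> * (k + 1) * N\<close>.\<close>
  finally have "(m - \<kappa> * real (Suc k)) * N \<le> 0" by (simp add: algebra_simps)
  moreover have "m - \<kappa> * real (Suc k) > 0" using large by (simp add: m_def)
  moreover have "N \<ge> 0" by (simp add: N_def sum_nonneg)
  ultimately have "N = 0" by (simp add: mult_le_0_iff)
  then have "\<forall>S\<in>faces (Suc k). \<phi> S = 0"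
    using finite_faces by (simp add: N_def sum_nonneg_eq_0_iff)
  then show ?thesis by (cases "S \<in> faces (Suc k)") (simp_all add: supp)
qed

text \<open>Subtract from \<open>z\<close> its projection to the boundaries. The remainder is still
  a cycle and, being orthogonal to boundaries, a cocycle; \<open>harmonic_eq_0\<close> makes it
  vanish.\<close>

lemma cycle_is_boundary:
  assumes supp: "\<And>S. S \<notin> faces (Suc k) \<Longrightarrow> z S = 0"
    and cycle: "\<And>S. S \<in> faces k \<Longrightarrow> bd g F z S = 0"
    and gap: "\<And>x :: 'v \<Rightarrow> real. (\<Sum>e\<in>F. \<Sum>f\<in>F. if adj e f then 0 else (x e - x f)\<^sup>2)
        \<le> 2 * \<kappa> * (\<Sum>e\<in>F. (x e)\<^sup>2)"
    and large: "real (card F) > \<kappa> * real (Suc k)"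
  obtains c where "\<And>S. S \<notin> faces (Suc (Suc k)) \<Longrightarrow> c S = 0" "\<And>S. bd g F c S = z S"
proof -
  define J where "J = faces (Suc (Suc k))"
  define \<delta> where "\<delta> T S = (if S = T then 1 else 0 :: real)" for T S :: "'v set"
  have finJ: "finite J" by (simp add: J_def finite_faces)
  obtain a where a: "\<forall>T\<in>J. (\<Sum>S\<in>faces (Suc k). (z S - (\<Sum>U\<in>J. a U * bd g F (\<delta> U) S)) * bd g F (\<delta> T) S) = 0"
    using orthogonal_remainder[OF finJ finite_faces[of "Suc k"],
        where z = z and A = "\<lambda>T. bd g F (\<delta> T)"] by blast
  define c where "c S = (\<Sum>U\<in>J. a U * \<delta> U S)" for S
  have c0: "c S = 0" if "S \<notin> J" for S
    using that by (auto simp: c_def \<delta>_def intro!: sum.neutral)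
  have bdc: "bd g F c S = (\<Sum>U\<in>J. a U * bd g F (\<delta> U) S)" for S
    unfolding c_def by (rule bd_sum)
  define \<phi> where "\<phi> S = z S - bd g F c S" for S
  have "\<phi> S = 0" for S
  proof (rule harmonic_eq_0[OF _ _ _ gap large])
    show "\<phi> S = 0" if "S \<notin> faces (Suc k)" for S
      using that supp bd_support[of "Suc k" c S] c0 by (simp add: \<phi>_def J_def)
    show "bd g F \<phi> S = 0" if "S \<in> faces k" for S
      using that cycle bd_bd[OF finF inj face_finite] by (simp add: \<phi>_def[abs_def] bd_diff)
    show "(\<Sum>u\<in>T. pos_sign g u T * \<phi> (T - {u})) = 0" if T: "T \<in> faces (Suc (Suc k))" for T
    proof -
      \<comment> \<open>Pairing with the boundary of the elementary chain \<open>\<delta> T\<close>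
        reads off the coboundary of \<open>\<phi>\<close> at \<open>T\<close>.\<close>
      have "0 = (\<Sum>S\<in>faces (Suc k). \<phi> S * bd g F (\<delta> T) S)"
        using a T by (simp add: \<phi>_def bdc J_def)
      also have "\<dots> = (\<Sum>T'\<in>J. \<delta> T T' * (\<Sum>u\<in>T'. pos_sign g u T' * \<phi> (T' - {u})))"
        unfolding J_def using T by (intro bd_adjoint) (auto simp: \<delta>_def)
      also have "\<dots> = (\<Sum>T'\<in>J. if T' = T then (\<Sum>u\<in>T'. pos_sign g u T' * \<phi> (T' - {u})) else 0)"
        by (intro sum.cong) (auto simp: \<delta>_def)
      also have "\<dots> = (\<Sum>u\<in>T. pos_sign g u T * \<phi> (T - {u}))"
        using finJ T by (simp add: J_def)
      finally show ?thesis by simp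
    qed
  qed
  then show ?thesis using that[of c] c0 by (simp add: \<phi>_def J_def)
qed

end

section \<open>Boundaries of elementary chains and change of vertex set\<close>

lemma bd_superset:
  assumes "finite E" "F \<subseteq> E" "\<And>S. c S \<noteq> 0 \<Longrightarrow> S \<subseteq> F"
  shows "bd g F c S = bd g E c S"
  unfolding bd_def
proof (rule sum.mono_neutral_left)
  show "\<forall>e\<in>E - S - (F - S). pos_sign g e S * c (insert e S) = 0"
    using assms(3) by fastforce
qed (use assms in auto)

lemma bd_indicator:
  assumes "finite E" "T \<subseteq> E"
  shows "bd g E (\<lambda>S. of_bool (S = T)) S = (\<Sum>e\<in>T. pos_sign g e T * of_bool (S = T - {e}))"
proof -
  define A where "A = {e \<in> T. S = T - {e}}"
  have finT: "finite T" using assms finite_subset by blast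
  have "bd g E (\<lambda>S. of_bool (S = T)) S = (\<Sum>e\<in>A. pos_sign g e T)"
    unfolding bd_def
  proof (rule sum.mono_neutral_cong_right)
    show "A \<subseteq> E - S" using assms(2) by (auto simp: A_def)
    show "\<forall>e\<in>E - S - A. pos_sign g e S * of_bool (insert e S = T) = 0"
      by (auto simp: A_def)
    show "pos_sign g e S * of_bool (insert e S = T) = pos_sign g e T" if "e \<in> A" for e
      using that by (auto simp: A_def pos_sign_remove insert_absorb)
  qed (use assms(1) in auto)
  also have "\<dots> = (\<Sum>e\<in>T. pos_sign g e T * of_bool (S = T - {e}))"
    by (rule sum.mono_neutral_cong_left) (use finT in \<open>auto simp: A_def\<close>)
  finally show ?thesis .
qed

lemma pos_sign_image:
  assumes "inj_on m I" "\<And>j. j \<in> I \<Longrightarrow> g (m j) < g (m i) \<longleftrightarrow> h j < h i"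
  shows "pos_sign g (m i) (m ` I) = pos_sign h i I"
proof -
  have "{f \<in> m ` I. g f < g (m i)} = m ` {j\<in>I. h j < h i}" using assms(2) by auto
  moreover have "inj_on m {j\<in>I. h j < h i}" by (rule inj_on_subset[OF assms(1)]) auto
  ultimately show ?thesis by (simp add: pos_sign_def card_image)
qed

text \<open>When \<open>m\<close> carries the order of \<open>h\<close> to that of \<open>g\<close>,
  the signs can be computed on the index set, hence agree for different transversals.\<close>

lemma bd_indicator_image:
  assumes "finite E" "m ` I \<subseteq> E" "inj_on m I"
    and "\<And>i j. i \<in> I \<Longrightarrow> j \<in> I \<Longrightarrow> g (m j) < g (m i) \<longleftrightarrow> h j < h i"
  shows "bd g E (\<lambda>S. of_bool (S = m ` I)) S
    = (\<Sum>i\<in>I. pos_sign h i I * of_bool (S = m ` (I - {i})))"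
proof -
  have "m ` (I - {i}) = m ` I - {m i}" if "i \<in> I" for i
    using that assms(3) by (auto dest: inj_onD)
  then show ?thesis
    using assms by (simp add: bd_indicator sum.reindex pos_sign_image)
qed

lemma pos_sign_remove_swap:
  assumes "finite I" "i \<in> I" "j \<in> I" "h i \<noteq> h j"
  shows "pos_sign h i I * pos_sign h j (I - {i}) = - (pos_sign h j I * pos_sign h i (I - {j}))"
proof -
  define J where "J = I - {i} - {j}"
  have J: "finite J" "i \<notin> J" "j \<notin> J" "I - {i} = insert j J" "I - {j} = insert i J"
    using assms by (auto simp: J_def)
  have "pos_sign h i I = pos_sign h i (insert j J)" "pos_sign h j I = pos_sign h j (insert i J)"
    using pos_sign_remove[of h i I] pos_sign_remove[of h j I] J by auto
  then show ?thesis using J assms(4) by (simp add: pos_sign_insert)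
qed

section \<open>Rainbow chains\<close>

text \<open>Induction on \<open>card I\<close>. The boundary prescribed for \<open>D I\<close> is
  supported on simplices of size \<open>card I\<close> in \<open>U I\<close>. It is a cycle: the
  terms from \<open>m\<close> and \<open>m'\<close> cancel, and deleting two indices in either order
  gives opposite signs. Then \<open>fill\<close> applies.\<close>

lemma rainbow_filling:
  fixes P :: "nat \<Rightarrow> 'v set" and g :: "'v \<Rightarrow> nat" and adj :: "'v \<Rightarrow> 'v \<Rightarrow> bool" and n :: nat
  defines "U \<equiv> \<lambda>I. \<Union>i\<in>I. P i"
  assumes fin: "finite (U {..<n})"
    and mono: "\<And>i j e f. i < j \<Longrightarrow> j < n \<Longrightarrow> e \<in> P i \<Longrightarrow> f \<in> P j \<Longrightarrow> g e < g f"
    and m: "\<And>i. i < n \<Longrightarrow> m i \<in> P i" "\<And>i j. i < n \<Longrightarrow> j < n \<Longrightarrow> i \<noteq> j \<Longrightarrow> adj (m i) (m j)"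
    and m': "\<And>i. i < n \<Longrightarrow> m' i \<in> P i" "\<And>i j. i < n \<Longrightarrow> j < n \<Longrightarrow> i \<noteq> j \<Longrightarrow> adj (m' i) (m' j)"
    and fill: "\<And>I k z. I \<subseteq> {..<n} \<Longrightarrow> card I = Suc k
      \<Longrightarrow> (\<And>S. S \<notin> cliques adj (U I) (Suc k) \<Longrightarrow> z S = 0)
      \<Longrightarrow> (\<And>S. finite S \<Longrightarrow> bd g (U I) z S = 0)
      \<Longrightarrow> \<exists>c. (\<forall>S. S \<notin> cliques adj (U I) (Suc (Suc k)) \<longrightarrow> c S = 0) \<and> (\<forall>S. bd g (U I) c S = z S)"
  obtains D where
    "\<And>I S. I \<subseteq> {..<n} \<Longrightarrow> S \<notin> cliques adj (U I) (Suc (card I)) \<Longrightarrow> D I S = 0"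
    "\<And>I S. I \<subseteq> {..<n} \<Longrightarrow> finite S \<Longrightarrow> bd g (U {..<n}) (D I) S
      = of_bool (S = m ` I) - of_bool (S = m' ` I) - (\<Sum>i\<in>I. pos_sign id i I * D (I - {i}) S)"
proof -
  let ?E = "U {..<n}"
  let ?faces = "\<lambda>I. cliques adj (U I)"
  define \<tau> where "\<tau> I S = (of_bool (S = m ` I) - of_bool (S = m' ` I) :: real)" for I S
  \<comment> \<open>\<open>D I\<close> lives one dimension above the transversals of
    \<open>I\<close>, hence \<open>Suc (card I)\<close>.\<close>
  define supp where "supp D I \<longleftrightarrow> (\<forall>S. S \<notin> ?faces I (Suc (card I)) \<longrightarrow> D I S = 0)"
    for D :: "nat set \<Rightarrow> 'v set \<Rightarrow> real" and I
  define fills where "fills D I \<longleftrightarrow> (\<forall>S. finite S \<longrightarrow>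
      bd g ?E (D I) S = \<tau> I S - (\<Sum>i\<in>I. pos_sign id i I * D (I - {i}) S))"
    for D :: "nat set \<Rightarrow> 'v set \<Rightarrow> real" and I
  have order: "g (p j) < g (p i) \<longleftrightarrow> id j < id i"
    if "\<And>i. i < n \<Longrightarrow> p i \<in> P i" "i < n" "j < n" for p i j
    using mono[of i j "p i" "p j"] mono[of j i "p j" "p i"] that
    by (cases i j rule: linorder_cases) (auto dest: less_asym)
  have inj: "inj_on p I" if "\<And>i. i < n \<Longrightarrow> p i \<in> P i" "I \<subseteq> {..<n}" for p I
  proof (rule inj_onI)
    fix i j assume "i \<in> I" "j \<in> I" "p i = p j"
    then show "i = j"
      using order[of p i j] order[of p j i] that by (cases i j rule: linorder_cases) auto
  qed
  have U_mono: "U I \<subseteq> U J" if "I \<subseteq> J" for I J using that by (auto simp: U_def)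
  have bd_\<tau>: "bd g ?E (\<tau> I) S = (\<Sum>i\<in>I. pos_sign id i I * \<tau> (I - {i}) S)"
    if I: "I \<subseteq> {..<n}" for I S
  proof -
    have bdp: "bd g ?E (\<lambda>S. of_bool (S = p ` I)) S
        = (\<Sum>i\<in>I. pos_sign id i I * of_bool (S = p ` (I - {i})))"
      if p: "\<And>i. i < n \<Longrightarrow> p i \<in> P i" for p
    proof (rule bd_indicator_image[OF fin])
      show "p ` I \<subseteq> ?E" using I p by (auto simp: U_def)
      show "inj_on p I" using p I by (rule inj)
      show "g (p j) < g (p i) \<longleftrightarrow> id j < id i" if "i \<in> I" "j \<in> I" for i j
        by (rule order[OF p]) (use that I in auto)
    qed
    have "bd g ?E (\<tau> I) S = bd g ?E (\<lambda>S. of_bool (S = m ` I)) S - bd g ?E (\<lambda>S. of_bool (S = m' ` I)) S"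
      unfolding \<tau>_def[abs_def] by (rule bd_diff)
    then show ?thesis using bdp[of m, OF m(1)] bdp[of m', OF m'(1)]
      by (simp add: \<tau>_def sum_subtractf right_diff_distrib)
  qed
  have image_face: "p ` I \<in> ?faces I (card I)"
    if I: "I \<subseteq> {..<n}" and p: "\<And>i. i < n \<Longrightarrow> p i \<in> P i"
      "\<And>i j. i < n \<Longrightarrow> j < n \<Longrightarrow> i \<noteq> j \<Longrightarrow> adj (p i) (p j)" for p I
  proof -
    have "card (p ` I) = card I" using p(1) I by (intro card_image inj)
    moreover have "p ` I \<subseteq> U I" using p(1) I by (auto simp: U_def)
    moreover have "adj e f" if ef: "e \<in> p ` I" "f \<in> p ` I" "e \<noteq> f" for e f
    proof -
      obtain i j where "i \<in> I" "j \<in> I" "e = p i" "f = p j" using ef(1,2) by blast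
      moreover from this have "i \<noteq> j" using ef(3) by blast
      ultimately show ?thesis using p(2)[of i j] I by blast
    qed
    ultimately show ?thesis unfolding cliques_def by blast
  qed
  have m_face: "m ` I \<in> ?faces I (card I)" "m' ` I \<in> ?faces I (card I)" if "I \<subseteq> {..<n}" for I
    using image_face[of I m] image_face[of I m'] that m m' by auto
  \<comment> \<open>All sets of size at most \<open>k\<close> are handled at once; the step chooses
    new chains only for size exactly \<open>Suc k\<close>, so the chains of the smaller sets they
    refer to stay fixed.\<close>
  have "\<exists>D. \<forall>I. I \<subseteq> {..<n} \<and> card I \<le> k \<longrightarrow> supp D I \<and> fills D I" for k
  proof (induction k)
    case 0
    \<comment> \<open>Both transversals of the empty set are the empty simplex, so the zero chain is
      a filling.\<close>
    have "I = {}" if "I \<subseteq> {..<n}" "card I \<le> 0" for I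
      using that finite_subset[of I "{..<n}"] by auto
    then have "\<forall>I. I \<subseteq> {..<n} \<and> card I \<le> 0 \<longrightarrow> supp (\<lambda>_ _. 0) I \<and> fills (\<lambda>_ _. 0) I"
      by (auto simp: supp_def fills_def \<tau>_def bd_def)
    then show ?case by blast
  next
    case (Suc k)
    then obtain D where D: "\<And>I. I \<subseteq> {..<n} \<Longrightarrow> card I \<le> k \<Longrightarrow> supp D I \<and> fills D I" by blast
    define R where "R I S = \<tau> I S - (\<Sum>i\<in>I. pos_sign id i I * D (I - {i}) S)" for I S
    have "\<exists>c. (\<forall>S. S \<notin> ?faces I (Suc (Suc k)) \<longrightarrow> c S = 0) \<and> (\<forall>S. bd g (U I) c S = R I S)"
      if I: "I \<subseteq> {..<n}" "card I = Suc k" for I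
    proof (rule fill[OF I])
      have finI: "finite I" using I(1) finite_subset by auto
      have sub: "I - {i} \<subseteq> {..<n}" "card (I - {i}) = k" if "i \<in> I" for i
        using that I finI by auto
      show R0: "R I S = 0" if S: "S \<notin> ?faces I (Suc k)" for S
      proof -
        have "\<tau> I S = 0"
          using S m_face[OF I(1)] I(2) by (auto simp: \<tau>_def)
        moreover have "D (I - {i}) S = 0" if i: "i \<in> I" for i
        proof -
          have "S \<notin> ?faces (I - {i}) (Suc k)"
            using S U_mono[of "I - {i}" I] unfolding cliques_def by blast
          then show ?thesis using D[OF sub(1)[OF i]] sub(2)[OF i] by (simp add: supp_def)
        qed
        ultimately show ?thesis by (simp add: R_def)
      qed
      show "bd g (U I) (R I) S = 0" if S: "finite S" for S
      proof -
        \<comment> \<open>The chains \<open>D (I - {i})\<close> live on different vertex sets, so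
          their boundaries are compared in all of \<open>?E\<close>.\<close>
        have "bd g (U I) (R I) S = bd g ?E (R I) S"
        proof (rule bd_superset[OF fin U_mono[OF I(1)]])
          show "T \<subseteq> U I" if "R I T \<noteq> 0" for T
            using that R0[of T] unfolding cliques_def by blast
        qed
        also have "\<dots> = bd g ?E (\<tau> I) S - (\<Sum>i\<in>I. pos_sign id i I * bd g ?E (D (I - {i})) S)"
          unfolding R_def[abs_def] bd_diff bd_sum ..
        also have "(\<Sum>i\<in>I. pos_sign id i I * bd g ?E (D (I - {i})) S)
          = (\<Sum>i\<in>I. pos_sign id i I * (\<tau> (I - {i}) S
              - (\<Sum>j\<in>I - {i}. pos_sign id j (I - {i}) * D (I - {i} - {j}) S)))"
          using D sub S by (intro sum.cong) (auto simp: fills_def)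
        \<comment> \<open>The boundary of \<open>\<tau> I\<close> cancels the \<open>\<tau>\<close>
          terms of the induction hypothesis; only chains with two indices deleted remain.\<close>
        also have "bd g ?E (\<tau> I) S - \<dots> = (\<Sum>i\<in>I. \<Sum>j\<in>I - {i}.
            pos_sign id i I * pos_sign id j (I - {i}) * D (I - {i} - {j}) S)"
          unfolding bd_\<tau>[OF I(1)]
          by (simp add: right_diff_distrib sum_subtractf sum_distrib_left mult.assoc)
        also have "\<dots> = 0"
        proof (rule sum_antisym_remove_eq_0[OF finI])
          fix i j assume "i \<in> I" "j \<in> I" "i \<noteq> j"
          moreover have "I - {i} - {j} = I - {j} - {i}" by blast
          ultimately show "pos_sign id i I * pos_sign id j (I - {i}) * D (I - {i} - {j}) S
            = - (pos_sign id j I * pos_sign id i (I - {j}) * D (I - {j} - {i}) S)"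
            using pos_sign_remove_swap[OF finI, of i j id] by simp
        qed
        finally show ?thesis .
      qed
    qed
    then obtain C where C: "\<And>I S. I \<subseteq> {..<n} \<Longrightarrow> card I = Suc k \<Longrightarrow> S \<notin> ?faces I (Suc (Suc k)) \<Longrightarrow> C I S = 0"
      "\<And>I S. I \<subseteq> {..<n} \<Longrightarrow> card I = Suc k \<Longrightarrow> bd g (U I) (C I) S = R I S"
      by metis
    define D' where "D' I = (if card I = Suc k then C I else D I)" for I
    have "supp D' I \<and> fills D' I" if I: "I \<subseteq> {..<n}" "card I \<le> Suc k" for I
    proof -
      have finI: "finite I" using I(1) finite_subset by auto
      have "card (I - {i}) \<noteq> Suc k" if "i \<in> I" for i
        using card_Diff1_less[OF finI that] I(2) by linarith
      then have D'D: "(\<Sum>i\<in>I. pos_sign id i I * D' (I - {i}) S) = (\<Sum>i\<in>I. pos_sign id i I * D (I - {i}) S)" for S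
        by (intro sum.cong) (auto simp: D'_def)
      show ?thesis
      proof (cases "card I = Suc k")
        case True
        have "bd g ?E (C I) S = bd g (U I) (C I) S" for S
        proof (rule bd_superset[OF fin U_mono[OF I(1)], symmetric])
          show "T \<subseteq> U I" if "C I T \<noteq> 0" for T
            using that C(1)[OF I(1) True, of T] unfolding cliques_def by blast
        qed
        then show ?thesis
          using True C[OF I(1) True] unfolding supp_def fills_def D'D by (simp add: D'_def R_def)
      next
        case False
        then show ?thesis
          using D[OF I(1)] I(2) unfolding supp_def fills_def D'D by (simp add: D'_def)
      qed
    qed
    then show ?case by blast
  qed
  from this[of n] obtain D where D: "\<And>I. I \<subseteq> {..<n} \<Longrightarrow> card I \<le> n \<Longrightarrow> supp D I \<and> fills D I" by blast
  have "supp D I \<and> fills D I" if "I \<subseteq> {..<n}" for I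
    using D[OF that] card_mono[OF _ that] by simp
  then show ?thesis using that[of D] unfolding supp_def fills_def \<tau>_def by blast
qed

section \<open>Ordering edges by class, and the spectral gap for intersecting edges\<close>

text \<open>A lexicographic key: the class comes first, and an enumeration \<open>h\<close> with
  values below \<open>card ?E\<close> breaks ties within a class.\<close>

lemma ex_colour_monotone_key:
  fixes P :: "nat \<Rightarrow> 'v set"
  assumes "finite (\<Union>i<n. P i)" "\<And>i j. i < n \<Longrightarrow> j < n \<Longrightarrow> i \<noteq> j \<Longrightarrow> P i \<inter> P j = {}"
  obtains g :: "'v \<Rightarrow> nat" where "inj_on g (\<Union>i<n. P i)"
    "\<And>i j e f. i < j \<Longrightarrow> j < n \<Longrightarrow> e \<in> P i \<Longrightarrow> f \<in> P j \<Longrightarrow> g e < g f"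
proof -
  let ?E = "\<Union>i<n. P i"
  obtain h where h: "bij_betw h ?E {0..<card ?E}"
    using ex_bij_betw_finite_nat[OF assms(1)] by blast
  define col where "col e = (THE i. i < n \<and> e \<in> P i)" for e
  have col: "col e = i" if "i < n" "e \<in> P i" for e i
    unfolding col_def using that assms(2) by (intro the_equality) blast+
  define g where "g e = col e * card ?E + h e" for e
  have less: "g e < g f" if "i < j" "j < n" "e \<in> P i" "f \<in> P j" for i j e f
  proof -
    have "e \<in> ?E" using that by force
    then have "h e < card ?E" using bij_betwE[OF h] by auto
    then have "g e < Suc i * card ?E" using col[of i e] that by (simp add: g_def)
    also have "\<dots> \<le> j * card ?E" using that by (intro mult_le_mono1) simp
    also have "\<dots> \<le> g f" using col[of j f] that by (simp add: g_def)
    finally show ?thesis .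
  qed
  moreover have "inj_on g ?E"
  proof (rule inj_onI)
    fix e f assume e: "e \<in> ?E" and f: "f \<in> ?E" and eq: "g e = g f"
    then obtain i j where ij: "i < n" "e \<in> P i" "j < n" "f \<in> P j" by blast
    then have "i = j"
      using less[of i j e f] less[of j i f e] eq by (cases i j rule: linorder_cases) auto
    then have "h e = h f" using eq col ij by (simp add: g_def)
    then show "e = f" using h e f by (auto simp: bij_betw_def dest: inj_onD)
  qed
  ultimately show ?thesis using that by blast
qed

text \<open>
  Each intersecting pair shares a vertex, and the pairs through a vertex \<open>v\<close> of degree \<open>d\<close> contribute
  \<open>2 d \<Sum> x\<^sup>2 - 2 (\<Sum> x)\<^sup>2\<close>.
\<close>

lemma intersection_gap:
  fixes F :: "'a set set" and x :: "'a set \<Rightarrow> real"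
  assumes "finite V" "finite F" "\<And>e. e \<in> F \<Longrightarrow> e \<subseteq> V \<and> card e = r"
    and deg: "\<And>v. v \<in> V \<Longrightarrow> card {e\<in>F. v \<in> e} \<le> \<Delta>"
  shows "(\<Sum>e\<in>F. \<Sum>f\<in>F. if e \<noteq> f \<and> e \<inter> f = {} then 0 else (x e - x f)\<^sup>2)
    \<le> 2 * real (r * \<Delta>) * (\<Sum>e\<in>F. (x e)\<^sup>2)"
proof -
  define S where "S v = {e\<in>F. v \<in> e}" for v
  have finS: "finite (S v)" for v using assms(2) by (simp add: S_def)
  \<comment> \<open>Counting a pair once per common vertex can only increase a sum of squares; a
    pair with \<open>e = f\<close> contributes 0 either way.\<close>
  have "(\<Sum>e\<in>F. \<Sum>f\<in>F. if e \<noteq> f \<and> e \<inter> f = {} then 0 else (x e - x f)\<^sup>2)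
    \<le> (\<Sum>e\<in>F. \<Sum>f\<in>F. \<Sum>v\<in>V. if v \<in> e \<and> v \<in> f then (x e - x f)\<^sup>2 else 0)"
  proof (intro sum_mono)
    fix e f assume ef: "e \<in> F" "f \<in> F"
    have nonneg: "0 \<le> (\<Sum>v\<in>V. if v \<in> e \<and> v \<in> f then (x e - x f)\<^sup>2 else 0)"
      by (intro sum_nonneg) auto
    show "(if e \<noteq> f \<and> e \<inter> f = {} then 0 else (x e - x f)\<^sup>2)
      \<le> (\<Sum>v\<in>V. if v \<in> e \<and> v \<in> f then (x e - x f)\<^sup>2 else 0)"
    proof (cases "e = f \<or> e \<inter> f = {}")
      case True
      then show ?thesis using nonneg by auto
    next
      case False
      then obtain v where v: "v \<in> e" "v \<in> f" by blast
      then have "v \<in> V" using assms(3) ef by blast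
      then have "(if v \<in> e \<and> v \<in> f then (x e - x f)\<^sup>2 else 0)
          \<le> (\<Sum>v\<in>V. if v \<in> e \<and> v \<in> f then (x e - x f)\<^sup>2 else 0)"
        using assms(1) by (intro member_le_sum) auto
      then show ?thesis using v False by simp
    qed
  qed
  also have "\<dots> = (\<Sum>v\<in>V. \<Sum>e\<in>F. \<Sum>f\<in>F. if v \<in> e \<and> v \<in> f then (x e - x f)\<^sup>2 else 0)"
    by (simp only: sum.swap[of _ V])
  also have "\<dots> = (\<Sum>v\<in>V. \<Sum>e\<in>S v. \<Sum>f\<in>S v. (x e - x f)\<^sup>2)"
  proof (rule sum.cong[OF refl], rule sum.mono_neutral_cong_right)
    fix v e assume e: "e \<in> S v"
    show "(\<Sum>f\<in>F. if v \<in> e \<and> v \<in> f then (x e - x f)\<^sup>2 else 0) = (\<Sum>f\<in>S v. (x e - x f)\<^sup>2)"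
      by (rule sum.mono_neutral_cong_right) (use e assms(2) in \<open>auto simp: S_def\<close>)
  qed (use assms(2) in \<open>auto simp: S_def\<close>)
  also have "\<dots> \<le> (\<Sum>v\<in>V. 2 * real \<Delta> * (\<Sum>e\<in>S v. (x e)\<^sup>2))"
  proof (rule sum_mono)
    fix v assume v: "v \<in> V"
    have "(\<Sum>e\<in>S v. \<Sum>f\<in>S v. (x e - x f)\<^sup>2)
      = (\<Sum>e\<in>S v. card (S v) * (x e)\<^sup>2 + (\<Sum>f\<in>S v. (x f)\<^sup>2) - 2 * x e * (\<Sum>f\<in>S v. x f))"
      by (intro sum.cong) (simp_all add: power2_diff sum.distrib sum_subtractf sum_distrib_left)
    also have "\<dots> = 2 * card (S v) * (\<Sum>e\<in>S v. (x e)\<^sup>2) - 2 * (\<Sum>e\<in>S v. x e)\<^sup>2"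
      by (simp add: sum.distrib sum_subtractf power2_eq_square[of "sum x (S v)"]
          flip: sum_distrib_left sum_distrib_right)
    also have "\<dots> \<le> 2 * real (card (S v)) * (\<Sum>e\<in>S v. (x e)\<^sup>2)" by simp
    also have "\<dots> \<le> 2 * real \<Delta> * (\<Sum>e\<in>S v. (x e)\<^sup>2)"
      using deg[OF v] by (intro mult_right_mono) (auto simp: S_def sum_nonneg)
    finally show "(\<Sum>e\<in>S v. \<Sum>f\<in>S v. (x e - x f)\<^sup>2) \<le> 2 * real \<Delta> * (\<Sum>e\<in>S v. (x e)\<^sup>2)" .
  qed
  also have "\<dots> = 2 * real \<Delta> * (\<Sum>v\<in>V. \<Sum>e\<in>F. if v \<in> e then (x e)\<^sup>2 else 0)"
    using assms(2) by (simp add: sum_distrib_left[symmetric] S_def sum.If_cases Int_def)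
  also have "(\<Sum>v\<in>V. \<Sum>e\<in>F. if v \<in> e then (x e)\<^sup>2 else 0) = (\<Sum>e\<in>F. \<Sum>v\<in>V. if v \<in> e then (x e)\<^sup>2 else 0)"
    by (rule sum.swap)
  also have "\<dots> = (\<Sum>e\<in>F. real r * (x e)\<^sup>2)"
  proof (rule sum.cong[OF refl])
    fix e assume "e \<in> F"
    then have "V \<inter> {v. v \<in> e} = e" "card e = r" using assms(3) by auto
    then show "(\<Sum>v\<in>V. if v \<in> e then (x e)\<^sup>2 else 0) = real r * (x e)\<^sup>2"
      using assms(1) by (simp add: sum.If_cases)
  qed
  finally show ?thesis by (simp add: sum_distrib_left[symmetric] algebra_simps)
qed

section \<open>Full rainbow matchings and components of the rainbow graph\<close>

lemma full_rainbow_matching_transversal: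
  assumes "is_partition E n P" "full_rainbow_matching E n P M"
  obtains m where "M = m ` {..<n}" "\<And>i. i < n \<Longrightarrow> m i \<in> P i"
    "\<And>i j. i < n \<Longrightarrow> j < n \<Longrightarrow> i \<noteq> j \<Longrightarrow> m i \<noteq> m j \<and> m i \<inter> m j = {}"
proof -
  have "\<exists>e. M \<inter> P i = {e}" if "i < n" for i
    using assms(2) that card_1_singletonE unfolding full_rainbow_matching_def by metis
  then obtain m where m: "\<And>i. i < n \<Longrightarrow> M \<inter> P i = {m i}" by metis
  have mM: "m i \<in> M" "m i \<in> P i" if "i < n" for i using m[OF that] by auto
  have "M \<subseteq> m ` {..<n}"
  proof
    fix e assume e: "e \<in> M"
    then have "e \<in> E" using assms(2) by (auto simp: full_rainbow_matching_def is_matching_def)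
    then obtain i where i: "i < n" "e \<in> P i" using assms(1) by (auto simp: is_partition_def)
    then have "e = m i" using m[OF i(1)] e by blast
    then show "e \<in> m ` {..<n}" using i by blast
  qed
  moreover have "m ` {..<n} \<subseteq> M" using mM by auto
  moreover have "m i \<noteq> m j \<and> m i \<inter> m j = {}" if "i < n" "j < n" "i \<noteq> j" for i j
  proof -
    have "P i \<inter> P j = {}" using assms(1) that by (simp add: is_partition_def)
    then have "m i \<noteq> m j" using mM(2)[OF that(1)] mM(2)[OF that(2)] by auto
    then show ?thesis using mM(1)[OF that(1)] mM(1)[OF that(2)] assms(2)
      by (simp add: full_rainbow_matching_def is_matching_def)
  qed
  ultimately show ?thesis using mM(2) by (intro that[of m]) auto
qed

lemma pos_sign_consecutive:
  assumes "finite T" "u \<in> T" "g u < g u'"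
    and "\<And>w. w \<in> T \<Longrightarrow> g w < g u' \<Longrightarrow> w = u \<or> g w < g u"
  shows "pos_sign g u' T = - pos_sign g u T"
proof -
  have "{w\<in>T. g w < g u'} = insert u {w\<in>T. g w < g u}" using assms by force
  then show ?thesis using assms(1) by (simp add: pos_sign_def)
qed

text \<open>The indicator of a union \<open>K\<close> of components has zero coboundary at
  \<open>T\<close>. If \<open>T - {u}\<close> is in \<open>K\<close>, then \<open>T\<close> has two
  edges in the class of \<open>u\<close> and one in every other class. Deleting either of the two
  gives adjacent rainbow matchings with opposite signs.\<close>

lemma component_coboundary:
  assumes part: "is_partition E n P" and fin: "finite E" and inj: "inj_on g E"
    and mono: "\<And>i j e f. i < j \<Longrightarrow> j < n \<Longrightarrow> e \<in> P i \<Longrightarrow> f \<in> P j \<Longrightarrow> g e < g f"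
    and T: "is_matching E T" "card T = n + 1"
    and rainbow: "\<And>N. N \<in> K \<Longrightarrow> full_rainbow_matching E n P N"
    and closed: "\<And>N N'. N \<in> K \<Longrightarrow> (N, N') \<in> RG_adj E n P \<Longrightarrow> N' \<in> K"
  shows "(\<Sum>u\<in>T. pos_sign g u T * of_bool (T - {u} \<in> K)) = 0"
proof (cases "\<exists>u\<in>T. T - {u} \<in> K")
  case False
  then show ?thesis by (intro sum.neutral) auto
next
  case True
  then obtain u where u: "u \<in> T" "T - {u} \<in> K" by blast
  have TE: "T \<subseteq> E" using T by (simp add: is_matching_def)
  have finT: "finite T" using TE fin finite_subset by blast
  have coloured: "\<exists>i<n. w \<in> P i" if "w \<in> T" for w
    using that TE part by (auto simp: is_partition_def)
  have disj: "i = j" if "w \<in> P i" "w \<in> P j" "i < n" "j < n" for w i j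
    using part that unfolding is_partition_def by blast
  have N1: "card ((T - {u}) \<inter> P i) = 1" if "i < n" for i
    using rainbow[OF u(2)] that by (simp add: full_rainbow_matching_def)
  obtain c where c: "c < n" "u \<in> P c" using coloured u(1) by blast
  obtain u' where u': "(T - {u}) \<inter> P c = {u'}"
    using N1[OF c(1)] card_1_singletonE by blast
  have u'T: "u' \<in> T" "u' \<noteq> u" "u' \<in> P c" using u' by auto
  have Tc: "T \<inter> P c = {u, u'}" using u' u c by auto
  have matching: "is_matching E (T - {w})" for w
    using T(1) by (auto simp: is_matching_def)
  have "card ((T - {u'}) \<inter> P i) = 1" if i: "i < n" for i
  proof (cases "i = c")
    case True
    then have "(T - {u'}) \<inter> P i = {u}" using Tc u'T by auto
    then show ?thesis by simp
  next
    case False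
    then have "u \<notin> P i" "u' \<notin> P i" using disj c i u'T by blast+
    then have "(T - {u'}) \<inter> P i = (T - {u}) \<inter> P i" by auto
    then show ?thesis using N1[OF i] by simp
  qed
  then have "full_rainbow_matching E n P (T - {u'})"
    using matching by (simp add: full_rainbow_matching_def)
  moreover have "(T - {u}) \<union> (T - {u'}) = T" using u'T by auto
  ultimately have "(T - {u}, T - {u'}) \<in> RG_adj E n P"
    using rainbow[OF u(2)] T by (simp add: RG_adj_def)
  then have u'K: "T - {u'} \<in> K" using closed u(2) by blast
  \<comment> \<open>Every class other than \<open>P c\<close> has a single edge in \<open>T\<close>;
    deleting that edge leaves the class unrepresented.\<close>
  have only: "T - {w} \<notin> K" if w: "w \<in> T" "w \<noteq> u" "w \<noteq> u'" for w
  proof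
    assume wK: "T - {w} \<in> K"
    obtain j where j: "j < n" "w \<in> P j" using coloured w(1) by blast
    then have "j \<noteq> c" using Tc w by auto
    then have "u \<notin> P j" using disj c j by blast
    obtain x where x: "(T - {u}) \<inter> P j = {x}" using N1[OF j(1)] card_1_singletonE by blast
    have "w \<in> (T - {u}) \<inter> P j" using w j by blast
    then have "(T - {u}) \<inter> P j = {w}" using x by simp
    then have "(T - {w}) \<inter> P j = {}" using \<open>u \<notin> P j\<close> by blast
    moreover have "card ((T - {w}) \<inter> P j) = 1"
      using rainbow[OF wK] j by (simp add: full_rainbow_matching_def)
    ultimately show False by simp
  qed
  \<comment> \<open>As \<open>g\<close> increases with the class, an edge of \<open>T\<close> with
    key between those of \<open>a\<close> and \<open>b\<close> would be a third edge of
    \<open>T\<close> in \<open>P c\<close>.\<close>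
  have flip: "pos_sign g b T = - pos_sign g a T"
    if ab: "T \<inter> P c = {a, b}" "g a < g b" for a b
  proof (rule pos_sign_consecutive[OF finT _ ab(2)])
    have abP: "a \<in> P c" "b \<in> P c" using ab(1) by auto
    show "a \<in> T" using ab(1) by auto
    fix w assume w: "w \<in> T" "g w < g b"
    then obtain j where j: "j < n" "w \<in> P j" using coloured by blast
    consider "j < c" | "j = c" | "c < j" by linarith
    then show "w = a \<or> g w < g a"
    proof cases
      case 1
      then show ?thesis using mono j c abP by blast
    next
      case 2
      then have "w \<in> {a, b}" using ab(1) w j by blast
      then show ?thesis using w by auto
    next
      case 3
      then have "g b < g w" using mono j abP by blast
      then show ?thesis using w by simp
    qed
  qed
  have "g u \<noteq> g u'" using inj u u'T TE by (auto dest: inj_onD)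
  then have sign: "pos_sign g u T + pos_sign g u' T = 0"
    using flip[of u u'] flip[of u' u] Tc by (cases "g u < g u'") (auto simp: insert_commute)
  have "(\<Sum>w\<in>T. pos_sign g w T * of_bool (T - {w} \<in> K)) = (\<Sum>w\<in>{u, u'}. pos_sign g w T)"
    by (rule sum.mono_neutral_cong_right) (use finT u u'T u'K only in auto)
  then show ?thesis using sign u'T by simp
qed

theorem theorem6p6:
  fixes V :: "'a set" and E :: "'a set set" and r n \<Delta> :: nat and P :: "nat \<Rightarrow> 'a set set"
  assumes "uniform_hypergraph r V E"
    and "\<Delta> = max_degree V E"
    and "is_partition E n P"
    and "\<forall>i<n. card (P i) \<ge> r * \<Delta> + 1"
  shows "RG_connected E n P"
proof -
  \<comment> \<open>Distinctness keeps \<open>adj\<close> irreflexive: the empty edge, possible for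
    \<open>r = 0\<close>, is disjoint from itself.\<close>
  define adj where "adj e f \<longleftrightarrow> e \<noteq> f \<and> e \<inter> f = {}" for e f :: "'a set"
  define U where "U I = (\<Union>i\<in>I. P i)" for I
  have UE: "U {..<n} = E" using assms(3) by (simp add: U_def is_partition_def)
  have disj: "P i \<inter> P j = {}" if "i < n" "j < n" "i \<noteq> j" for i j
    using assms(3) that by (simp add: is_partition_def)
  have edge: "e \<subseteq> V \<and> card e = r" if "e \<in> E" for e
    using assms(1) that by (auto simp: uniform_hypergraph_def)
  have "finite V" using assms(1) by (simp add: uniform_hypergraph_def)
  then have finE: "finite E" using edge by (intro finite_subset[of E "Pow V"]) auto
  have deg: "card {e\<in>E. v \<in> e} \<le> \<Delta>" if "v \<in> V" for v
    using that \<open>finite V\<close> unfolding assms(2) max_degree_def degree_def by (intro Max_ge) auto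
  obtain g :: "'a set \<Rightarrow> nat" where inj: "inj_on g E"
    and mono: "\<And>i j e f. i < j \<Longrightarrow> j < n \<Longrightarrow> e \<in> P i \<Longrightarrow> f \<in> P j \<Longrightarrow> g e < g f"
    using ex_colour_monotone_key[of P n, folded U_def, unfolded UE, OF finE disj] by blast
  have subE: "U I \<subseteq> E" if "I \<subseteq> {..<n}" for I using that UE by (auto simp: U_def)
  have complex: "flag_complex g (U I) adj" if "I \<subseteq> {..<n}" for I
    using finite_subset[OF subE[OF that] finE] inj_on_subset[OF inj subE[OF that]]
    by unfold_locales (auto simp: adj_def)
  have fill: "\<exists>c. (\<forall>S. S \<notin> cliques adj (U I) (Suc (Suc k)) \<longrightarrow> c S = 0)
      \<and> (\<forall>S. bd g (U I) c S = z S)"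
    if I: "I \<subseteq> {..<n}" "card I = Suc k"
      and z: "\<And>S. S \<notin> cliques adj (U I) (Suc k) \<Longrightarrow> z S = 0"
        "\<And>S. finite S \<Longrightarrow> bd g (U I) z S = 0" for I k z
  proof -
    interpret flag_complex g "U I" adj by (rule complex[OF I(1)])
    have finI: "finite I" using I(1) finite_subset by auto
    \<comment> \<open>The gap constant is \<open>r * \<Delta>\<close>, since degrees can only drop
      in the subfamily \<open>U I\<close>.\<close>
    have gap: "(\<Sum>e\<in>U I. \<Sum>f\<in>U I. if adj e f then 0 else (x e - x f)\<^sup>2)
        \<le> 2 * real (r * \<Delta>) * (\<Sum>e\<in>U I. (x e)\<^sup>2)" for x :: "'a set \<Rightarrow> real"
      unfolding adj_def
    proof (rule intersection_gap[OF \<open>finite V\<close> finF])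
      show "e \<subseteq> V \<and> card e = r" if "e \<in> U I" for e using that edge subE[OF I(1)] by blast
      show "card {e\<in>U I. v \<in> e} \<le> \<Delta>" if "v \<in> V" for v
      proof -
        have "card {e\<in>U I. v \<in> e} \<le> card {e\<in>E. v \<in> e}"
          using finE subE[OF I(1)] by (intro card_mono) auto
        then show ?thesis using deg[OF that] by linarith
      qed
    qed
    have "card (U I) = (\<Sum>i\<in>I. card (P i))"
      unfolding U_def
    proof (rule card_UN_disjoint[OF finI])
      show "\<forall>i\<in>I. finite (P i)"
        using finF finI by (auto simp: U_def)
      show "\<forall>i\<in>I. \<forall>j\<in>I. i \<noteq> j \<longrightarrow> P i \<inter> P j = {}" using disj I(1) by blast
    qed
    also have "\<dots> \<ge> (\<Sum>i\<in>I. r * \<Delta> + 1)" using assms(4) I(1) by (intro sum_mono) auto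
    \<comment> \<open>The one extra edge in each of the \<open>Suc k\<close> classes makes this
      strict.\<close>
    finally have "r * \<Delta> * Suc k < card (U I)" using I(2) by (simp add: algebra_simps)
    then have large: "real (r * \<Delta>) * real (Suc k) < real (card (U I))"
      unfolding of_nat_mult[symmetric] of_nat_less_iff .
    show ?thesis
    proof (rule cycle_is_boundary[OF _ _ gap large])
      show "z S = 0" if "S \<notin> faces (Suc k)" for S using z(1) that .
      show "bd g (U I) z S = 0" if "S \<in> faces k" for S using z(2) face_finite[OF that] .
    qed blast
  qed
  show ?thesis unfolding RG_connected_def
  proof (intro allI impI)
    fix M M' assume M: "full_rainbow_matching E n P M" and M': "full_rainbow_matching E n P M'"
    obtain m where m: "M = m ` {..<n}" "\<And>i. i < n \<Longrightarrow> m i \<in> P i"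
      "\<And>i j. i < n \<Longrightarrow> j < n \<Longrightarrow> i \<noteq> j \<Longrightarrow> m i \<noteq> m j \<and> m i \<inter> m j = {}"
      using full_rainbow_matching_transversal[OF assms(3) M] by metis
    obtain m' where m': "M' = m' ` {..<n}" "\<And>i. i < n \<Longrightarrow> m' i \<in> P i"
      "\<And>i j. i < n \<Longrightarrow> j < n \<Longrightarrow> i \<noteq> j \<Longrightarrow> m' i \<noteq> m' j \<and> m' i \<inter> m' j = {}"
      using full_rainbow_matching_transversal[OF assms(3) M'] by metis
    obtain D where D: "\<And>I S. I \<subseteq> {..<n} \<Longrightarrow> S \<notin> cliques adj (U I) (Suc (card I)) \<Longrightarrow> D I S = 0"
      and bdD: "\<And>I S. I \<subseteq> {..<n} \<Longrightarrow> finite S \<Longrightarrow> bd g E (D I) S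
        = of_bool (S = m ` I) - of_bool (S = m' ` I) - (\<Sum>i\<in>I. pos_sign id i I * D (I - {i}) S)"
    proof (rule rainbow_filling[of P n g m adj m', folded U_def, unfolded UE])
      show "finite E" by (rule finE)
      show "g e < g f" if "i < j" "j < n" "e \<in> P i" "f \<in> P j" for i j e f
        using mono that .
      show "m i \<in> P i" "m' i \<in> P i" if "i < n" for i using m m' that by auto
      show "adj (m i) (m j)" "adj (m' i) (m' j)" if "i < n" "j < n" "i \<noteq> j" for i j
        using m(3) m'(3) that by (auto simp: adj_def)
    qed (rule fill, assumption+, blast)
    interpret flag_complex g E adj using complex[of "{..<n}"] UE by simp
    have face_iff: "S \<in> faces k \<longleftrightarrow> is_matching E S \<and> card S = k" for S k
      by (auto simp: cliques_def is_matching_def adj_def)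
    \<comment> \<open>The component of \<open>M\<close> in the rainbow graph.\<close>
    define K where "K = {N. (M, N) \<in> (RG_adj E n P)\<^sup>* \<and> full_rainbow_matching E n P N}"
    show "(M, M') \<in> (RG_adj E n P)\<^sup>*"
    proof (rule ccontr)
      assume not: "(M, M') \<notin> (RG_adj E n P)\<^sup>*"
      \<comment> \<open>The indicator of \<open>K\<close> is paired with the boundary of the top
        chain. Adjointness gives 0, direct evaluation gives 1.\<close>
      have "(\<Sum>S\<in>faces n. of_bool (S \<in> K) * bd g E (D {..<n}) S)
        = (\<Sum>T\<in>faces (Suc n). D {..<n} T * (\<Sum>u\<in>T. pos_sign g u T * of_bool (T - {u} \<in> K)))"
      proof (rule bd_adjoint)
        show "D {..<n} S = 0" if "S \<notin> faces (Suc n)" for S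
          using D[of "{..<n}" S] that UE by simp
      qed
      also have "\<dots> = 0"
      proof (intro sum.neutral ballI)
        fix T assume T: "T \<in> faces (Suc n)"
        have "(\<Sum>u\<in>T. pos_sign g u T * of_bool (T - {u} \<in> K)) = 0"
        proof (rule component_coboundary[OF assms(3) finE inj mono])
          show "is_matching E T" "card T = n + 1" using T face_iff by auto
          show "full_rainbow_matching E n P N" if "N \<in> K" for N using that by (simp add: K_def)
          show "N' \<in> K" if "N \<in> K" "(N, N') \<in> RG_adj E n P" for N N'
            using that by (auto simp: K_def RG_adj_def intro: rtrancl_into_rtrancl)
        qed
        then show "D {..<n} T * (\<Sum>u\<in>T. pos_sign g u T * of_bool (T - {u} \<in> K)) = 0" by simp
      qed
      also have "(\<Sum>S\<in>faces n. of_bool (S \<in> K) * bd g E (D {..<n}) S) = (\<Sum>S\<in>faces n. of_bool (S = M))"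
      proof (rule sum.cong[OF refl])
        fix S assume S: "S \<in> faces n"
        show "of_bool (S \<in> K) * bd g E (D {..<n}) S = (of_bool (S = M) :: real)"
        proof (cases "S \<in> K")
          case True
          \<comment> \<open>The recursive chains use no edge of \<open>P i\<close>, but a full
            rainbow matching does, so they vanish on \<open>K\<close>.\<close>
          have "D ({..<n} - {i}) S = 0" if i: "i < n" for i
          proof (rule D)
            have "card (S \<inter> P i) = 1" using True i by (simp add: K_def full_rainbow_matching_def)
            then obtain e where e: "e \<in> S" "e \<in> P i" by (metis Int_iff card_1_singletonE insertI1)
            have "e \<notin> U ({..<n} - {i})" using e disj[OF _ i] by (auto simp: U_def)
            then show "S \<notin> cliques adj (U ({..<n} - {i})) (Suc (card ({..<n} - {i})))"
              using e(1) unfolding cliques_def by blast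
          qed auto
          \<comment> \<open>Unreachability of \<open>M'\<close> removes its coefficient -1, leaving
            only that of \<open>M\<close>.\<close>
          moreover have "S \<noteq> M'" using True not by (auto simp: K_def)
          ultimately show ?thesis
            using True bdD[of "{..<n}" S] face_finite[OF S] m(1) m'(1) by simp
        next
          case False
          then have "S \<noteq> M" using M by (auto simp: K_def)
          then show ?thesis using False by simp
        qed
      qed
      also have "\<dots> = 1"
      proof -
        have "inj_on m {..<n}" using m(3) by (auto intro!: inj_onI)
        then have "card M = n" using m(1) by (simp add: card_image)
        then have "M \<in> faces n" using M face_iff by (simp add: full_rainbow_matching_def)
        then show ?thesis using finite_faces[of n] by simp
      qed
      finally show False by simp
    qed
  qed
qed

end
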